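(* Let $(a_n)_{n \geq 1}$ be a sequence of non-negative real numbers and suppose that there are constants $c, C, \alpha > 0$ and $\delta \ge 0$ such that, for all large enough $n$, \[c\,n^{\alpha} \leq a_n \leq C n^{\alpha + \delta}.\] Let $\epsilon_1,\epsilon_2,\dots$ be independent random variables taking the values $\pm1$ each with probability $1/2$. Then, for any $\gamma > 0$, \[Q_1\left(\sum_{i=1}^n \epsilon_i a_i\right) = O\left(n^{-\left(\frac{1}{2} + \alpha f(\alpha, \delta) - \gamma\right)}\right) \quad\text{as } n\to\infty,\] where \[f(\alpha, \delta) = \begin{cases} \dfrac{\alpha^2}{(\alpha + \delta) \left(\alpha + 2 \delta + 2 \sqrt{\delta^2 + \alpha \delta}\right)} & \text{if } \delta \leq \frac{\sqrt{\alpha^2 + 1} - \alpha}{2},\\[2ex] \dfrac{\alpha^2}{(\alpha + \delta)(1 + 2 \delta) (\alpha + 1/2 + \delta)} & \text{if } \delta \geq \frac{\sqrt{\alpha^2 + 1} - \alpha}{2}. \end{cases}\]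
   Context: For a real-valued random variable $A$ and $r>0$, the (Lévy) concentration function is $Q_r(A) = \sup_{x \in \mathbb{R}} \mathbb{P}(x < A \le x+r)$. The implied constant in $O(\cdot)$ may depend on the sequence $(a_n)$ and on $c,C,\alpha,\delta,\gamma$ but not on $n$. *)

theory Defs
  imports "HOL-Probability.Probability" "HOL-Library.Landau_Symbols"
begin

definition concentration :: "'a measure \<Rightarrow> real \<Rightarrow> ('a \<Rightarrow> real) \<Rightarrow> real" where
  "concentration M r A = (SUP x::real. measure M {\<omega> \<in> space M. x < A \<omega> \<and> A \<omega> \<le> x + r})"

(* The two branches agree at the threshold, where sqrt (\<delta>\<^sup>2 + \<alpha> * \<delta>) = 1 / 2. *)
definition f_exponent :: "real \<Rightarrow> real \<Rightarrow> real" where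
  "f_exponent \<alpha> \<delta> =
     (if \<delta> \<le> (sqrt (\<alpha>\<^sup>2 + 1) - \<alpha>) / 2
      then \<alpha>\<^sup>2 / ((\<alpha> + \<delta>) * (\<alpha> + 2 * \<delta> + 2 * sqrt (\<delta>\<^sup>2 + \<alpha> * \<delta>)))
      else \<alpha>\<^sup>2 / ((\<alpha> + \<delta>) * (1 + 2 * \<delta>) * (\<alpha> + 1 / 2 + \<delta>)))"

end

theory Submission
  imports Defs "HOL-Real_Asymp.Real_Asymp"
begin

text \<open>
  The sum $S_n = \sum_{i \le n} \epsilon_i a_i$ is split as $X + Y$, where $Y = S_m$ collects the
  first $m \approx n^\beta$ terms. Two facts compete in the choice of $\beta$.

  \<^item> Hoeffding's inequality confines $Y$ to $[-n^\kappa, n^\kappa]$ up to an error that decays faster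
    than every power of $n$, as soon as $\kappa > \beta (\alpha + \delta + 1/2)$
    (\<open>initial_segment_tail\<close>).
  \<^item> The terms of $X$ with index above $n/2$ have size at least of order $n^\alpha$. If
    $\kappa < \alpha$, they are longer than the window $n^\kappa$, and the Littlewood--Offord bound of
    Erdos gives $Q_{2 n^\kappa + 1}(X) = O(n^{-1/2})$ (\<open>concentration_upper_half\<close>).

  On the event $|Y| < n^\kappa$, the sum can hit an interval of length $1$ only if $X$ hits an interval
  of length $2 n^\kappa + 1$; given any such value of $X$, independence bounds the chance that $Y$
  corrects it precisely by $Q_1(Y)$. Hence, up to a negligible error,
  $Q_1(S_n) \le O(n^{-1/2}) \, Q_1(S_m)$, and a bound with exponent $e$ improves to one with exponent
  $1/2 + \beta e$ (\<open>concentration_bootstrap\<close>). Both facts are available for all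
  $\beta < \beta_0 = \alpha / (\alpha + \delta + 1/2)$. Starting from the trivial exponent $0$,
  finitely many rounds reach every exponent below the fixed point
  $1 / (2 (1 - \beta_0)) = 1/2 + \alpha / (1 + 2 \delta)$ (\<open>concentration_bound\<close>). The exponent
  of the theorem is below this one, because $f(\alpha, \delta) \le 1 / (1 + 2 \delta)$
  (\<open>f_exponent_le\<close>).
\<close>

section \<open>Antichains and central binomial coefficients\<close>

text \<open>
  Induction on the size of the ground set: since
  $1/\binom{n}{k} = \frac{n-k}{n} \cdot 1/\binom{n-1}{k}$, each weight other than that of the full
  set is the average, over the $n$ points $x$, of the weight that the set has as a subset of
  $I - \{x\}$, counted as $0$ if it contains $x$. An antichain that contains the full set is a
  singleton.
\<close>

lemma lym_inequality:
  fixes I :: "'i set"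
  assumes "finite I" "F \<subseteq> Pow I" "\<And>A B. A \<in> F \<Longrightarrow> B \<in> F \<Longrightarrow> \<not> A \<subset> B"
  shows "(\<Sum>A\<in>F. 1 / real (card I choose card A)) \<le> 1"
  using assms
proof (induction "card I" arbitrary: I F rule: less_induct)
  case less
  note fin = \<open>finite I\<close>
  have finF: "finite F"
    using less.prems(1,2) by (meson finite_Pow_iff finite_subset)
  show ?case
  proof (cases "I \<in> F")
    case True
    then have "F = {I}"
      using less.prems(2,3) by blast
    then show ?thesis by simp
  next
    case False
    show ?thesis
    proof (cases "I = {}")
      case True
      then have "F = {}" using False less.prems(2) by auto
      then show ?thesis by simp
    next
      case nonempty: False
      define n where "n = card I"
      have n: "n > 0" using nonempty fin by (simp add: n_def card_gt_0_iff)
      have split_term: "1 / real (n choose card A)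
          = (\<Sum>x\<in>I. if x \<notin> A then 1 / (real n * real (n - 1 choose card A)) else 0)"
        if "A \<in> F" for A
      proof -
        have A: "A \<subset> I" using that False less.prems(2) by auto
        then have lt: "card A < n" unfolding n_def by (intro psubset_card_mono fin)
        have "real (n - card A) * real (n choose card A) = real n * real (n - 1 choose card A)"
          using binomial_absorb_comp[of n "card A"] by (metis of_nat_mult)
        moreover have "(n - 1 choose card A) > 0" "(n choose card A) > 0"
          using lt by (auto simp: zero_less_binomial_iff)
        ultimately have "1 / real (n choose card A)
            = real (n - card A) * (1 / (real n * real (n - 1 choose card A)))"
          using n by (simp add: field_simps)
        moreover have "card (I - A) = n - card A"
          using A fin by (metis n_def card_Diff_subset finite_subset psubset_imp_subset)
        moreover have "(\<Sum>x\<in>I. if x \<notin> A then t else 0) = real (card (I - A)) * t" for t :: real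
          using fin by (simp add: sum.If_cases set_diff_eq Int_def)
        ultimately show ?thesis by simp
      qed
      have "(\<Sum>A\<in>F. 1 / real (card I choose card A))
          = (\<Sum>A\<in>F. \<Sum>x\<in>I. if x \<notin> A then 1 / (real n * real (n - 1 choose card A)) else 0)"
        using split_term by (simp add: n_def)
      also have "\<dots> = (\<Sum>x\<in>I. \<Sum>A\<in>F. if x \<notin> A then 1 / (real n * real (n - 1 choose card A)) else 0)"
        by (rule sum.swap)
      also have "\<dots> \<le> (\<Sum>x\<in>I. 1 / real n)"
      proof (rule sum_mono)
        fix x assume x: "x \<in> I"
        have card: "card (I - {x}) = n - 1" using x by (simp add: n_def)
        have "(\<Sum>A\<in>{A\<in>F. x \<notin> A}. 1 / real (card (I - {x}) choose card A)) \<le> 1"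
        proof (rule less.hyps)
          show "card (I - {x}) < card I" using x fin by (intro psubset_card_mono) auto
        qed (use less.prems in auto)
        then have "(\<Sum>A\<in>{A\<in>F. x \<notin> A}. 1 / real (n - 1 choose card A)) / real n \<le> 1 / real n"
          using n by (simp add: card divide_right_mono)
        moreover have "(\<Sum>A\<in>F. if x \<notin> A then 1 / (real n * real (n - 1 choose card A)) else 0)
            = (\<Sum>A\<in>{A\<in>F. x \<notin> A}. 1 / real (n - 1 choose card A)) / real n"
          using finF by (auto simp: sum.inter_filter sum_divide_distrib mult.commute intro!: sum.cong)
        ultimately show "(\<Sum>A\<in>F. if x \<notin> A then 1 / (real n * real (n - 1 choose card A)) else 0)
            \<le> 1 / real n" by simp
      qed
      also have "\<dots> = 1" using n by (simp add: n_def)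
      finally show ?thesis .
    qed
  qed
qed

corollary sperner:
  fixes I :: "'i set"
  assumes "finite I" "F \<subseteq> Pow I" "\<And>A B. A \<in> F \<Longrightarrow> B \<in> F \<Longrightarrow> \<not> A \<subset> B"
  shows "card F \<le> card I choose (card I div 2)"
proof -
  let ?b = "card I choose (card I div 2)"
  have pos: "?b > 0" by (simp add: zero_less_binomial_iff)
  have "real (card F) / ?b = (\<Sum>A\<in>F. 1 / real ?b)" by simp
  also have "\<dots> \<le> (\<Sum>A\<in>F. 1 / real (card I choose card A))"
  proof (rule sum_mono)
    fix A assume "A \<in> F"
    then have "card A \<le> card I" using assms(1,2) by (auto intro: card_mono)
    then have "(card I choose card A) > 0" by (simp add: zero_less_binomial_iff)
    moreover have "card I choose card A \<le> ?b" by (rule binomial_maximum)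
    ultimately show "1 / real ?b \<le> 1 / real (card I choose card A)"
      by (intro divide_left_mono) auto
  qed
  also have "\<dots> \<le> 1" by (rule lym_inequality[OF assms])
  finally show ?thesis using pos by (simp add: field_simps)
qed

text \<open>
  Squared and multiplied by $2k + 1$, the left-hand side is non-increasing in $k$, because
  $(2k+1)(2k+3) \le 4 (k+1)^2$.
\<close>

lemma central_binomial_upper_bound:
  "real (2 * k choose k) / 2 ^ (2 * k) \<le> 1 / sqrt (real (2 * k + 1))"
proof -
  have "(real (2 * k choose k))\<^sup>2 * real (2 * k + 1) \<le> (16::real) ^ k"
  proof (induction k)
    case (Suc k)
    have "Suc k * (2 * Suc k choose Suc k) = 2 * (Suc k * (2 * k + 1 choose k))"
      using Suc_times_binomial[of k "2 * k + 1"] by (simp del: binomial_Suc_Suc)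
    also have "Suc k * (2 * k + 1 choose k) = (2 * k + 1) * (2 * k choose k)"
      using binomial_absorb_comp[of "2 * k + 1" k] by (simp del: binomial_Suc_Suc)
    finally have "Suc k * (2 * Suc k choose Suc k) = 2 * (2 * k + 1) * (2 * k choose k)"
      by (simp only: mult.assoc)
    then have rec: "real (Suc k) * real (2 * Suc k choose Suc k)
        = 2 * real (2 * k + 1) * real (2 * k choose k)"
      by (metis of_nat_mult of_nat_numeral)
    have "(real (Suc k))\<^sup>2 * ((real (2 * Suc k choose Suc k))\<^sup>2 * real (2 * Suc k + 1))
        = (2 * real (2 * k + 1) * real (2 * k choose k))\<^sup>2 * real (2 * k + 3)"
      by (simp only: rec[symmetric] power_mult_distrib) (simp add: algebra_simps)
    also have "\<dots> = 4 * (real (2 * k + 1) * real (2 * k + 3))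
        * ((real (2 * k choose k))\<^sup>2 * real (2 * k + 1))"
      by (simp add: power2_eq_square) (simp add: algebra_simps)
    also have "\<dots> \<le> 4 * (4 * (real (Suc k))\<^sup>2) * 16 ^ k"
    proof (rule mult_mono[OF _ Suc.IH])
      show "4 * (real (2 * k + 1) * real (2 * k + 3)) \<le> 4 * (4 * (real (Suc k))\<^sup>2)"
        by (simp add: power2_eq_square) (simp add: algebra_simps)
    qed auto
    finally have "(real (Suc k))\<^sup>2 * ((real (2 * Suc k choose Suc k))\<^sup>2 * real (2 * Suc k + 1))
        \<le> (real (Suc k))\<^sup>2 * 16 ^ Suc k" by simp
    then show ?case by (subst (asm) mult_le_cancel_left_pos) auto
  qed simp
  then have "sqrt ((real (2 * k choose k))\<^sup>2 * real (2 * k + 1)) \<le> sqrt ((4 ^ k)\<^sup>2)"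
    by (intro real_sqrt_le_mono) (simp add: power2_eq_square flip: power_mult_distrib)
  then have "real (2 * k choose k) * sqrt (real (2 * k + 1)) \<le> 2 ^ (2 * k)"
    by (simp add: real_sqrt_mult power_mult)
  then show ?thesis by (simp add: field_simps)
qed

section \<open>The concentration function and independence\<close>

context prob_space
begin

lemma prob_le_concentration:
  "prob {\<omega> \<in> space M. x < X \<omega> \<and> X \<omega> \<le> x + r} \<le> concentration M r X"
  unfolding concentration_def by (rule cSUP_upper) (auto intro!: bdd_aboveI[of _ 1])

lemma concentration_leI:
  "(\<And>x. prob {\<omega> \<in> space M. x < X \<omega> \<and> X \<omega> \<le> x + r} \<le> b) \<Longrightarrow> concentration M r X \<le> b"
  unfolding concentration_def by (rule cSUP_least) auto

lemma concentration_nonneg: "concentration M r X \<ge> 0"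
  using prob_le_concentration[of 0 X r] measure_nonneg order_trans by blast

lemma concentration_le_1: "concentration M r X \<le> 1"
  by (rule concentration_leI) simp

text \<open>
  By Fubini: for each fixed value $u \in J$ of $X$, the sum falls into the interval only if $Y$ falls
  into its translate by $-u$, whatever $u$ is. The event $X \in J$ is kept as a separate factor; this
  is what allows one to gain from both summands.
\<close>

lemma prob_indep_sum_le:
  fixes X Y :: "'a \<Rightarrow> real"
  assumes ind: "indep_var borel X borel Y" and J: "J \<in> sets borel"
  shows "prob {\<omega> \<in> space M. X \<omega> \<in> J \<and> x < X \<omega> + Y \<omega> \<and> X \<omega> + Y \<omega> \<le> x + r}
    \<le> prob {\<omega> \<in> space M. X \<omega> \<in> J} * concentration M r Y"
proof -
  have [measurable]: "X \<in> borel_measurable M" "Y \<in> borel_measurable M"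
    and joint: "distr M borel X \<Otimes>\<^sub>M distr M borel Y
      = distr M (borel \<Otimes>\<^sub>M borel) (\<lambda>\<omega>. (X \<omega>, Y \<omega>))"
    using ind unfolding indep_var_distribution_eq by auto
  note J[measurable]
  interpret Y: prob_space "distr M borel Y" by (rule prob_space_distr) simp
  let ?E = "(J \<times> UNIV) \<inter> ((\<lambda>(u, v). u + v) -` {x<..x + r} \<inter> space (borel \<Otimes>\<^sub>M borel))
    :: (real \<times> real) set"
  let ?q = "ennreal (concentration M r Y)"
  have E [measurable]: "?E \<in> sets (borel \<Otimes>\<^sub>M borel)"
    by (intro sets.Int pair_measureI measurable_sets[of _ _ borel]) auto
  have "emeasure M {\<omega> \<in> space M. X \<omega> \<in> J \<and> x < X \<omega> + Y \<omega> \<and> X \<omega> + Y \<omega> \<le> x + r}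
      = emeasure (distr M borel X \<Otimes>\<^sub>M distr M borel Y) ?E"
    unfolding joint by (subst emeasure_distr) (auto intro!: arg_cong[where f = "emeasure M"] simp: space_pair_measure)
  also have "\<dots> = (\<integral>\<^sup>+u. emeasure (distr M borel Y) (Pair u -` ?E) \<partial>distr M borel X)"
    using E by (intro Y.emeasure_pair_measure_alt) (simp cong: sets_pair_measure_cong)
  also have "\<dots> \<le> (\<integral>\<^sup>+u. ?q * indicator J u \<partial>distr M borel X)"
  proof (rule nn_integral_mono)
    fix u
    show "emeasure (distr M borel Y) (Pair u -` ?E) \<le> ?q * indicator J u"
    proof (cases "u \<in> J")
      case True
      have "Pair u -` ?E = {v. x - u < v \<and> v \<le> (x - u) + r}"
        using True by (auto simp: space_pair_measure)
      then have "emeasure (distr M borel Y) (Pair u -` ?E)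
          = emeasure M {\<omega> \<in> space M. x - u < Y \<omega> \<and> Y \<omega> \<le> (x - u) + r}"
        by (simp only:) (subst emeasure_distr; auto intro!: arg_cong[where f = "emeasure M"])
      then show ?thesis
        using True prob_le_concentration[of "x - u" Y r] by (simp add: emeasure_eq_measure ennreal_leI)
    qed (auto simp: space_pair_measure)
  qed
  also have "\<dots> = ?q * emeasure (distr M borel X) J"
    by (rule nn_integral_cmult_indicator) simp
  also have "emeasure (distr M borel X) J = emeasure M {\<omega> \<in> space M. X \<omega> \<in> J}"
    by (subst emeasure_distr) (auto intro!: arg_cong[where f = "emeasure M"])
  finally have "ennreal (prob {\<omega> \<in> space M. X \<omega> \<in> J \<and> x < X \<omega> + Y \<omega> \<and> X \<omega> + Y \<omega> \<le> x + r})
      \<le> ennreal (prob {\<omega> \<in> space M. X \<omega> \<in> J} * concentration M r Y)"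
    by (simp add: emeasure_eq_measure ennreal_mult' mult.commute concentration_nonneg)
  then show ?thesis by (simp add: concentration_nonneg)
qed

lemma concentration_indep_sum_le:
  fixes X Y :: "'a \<Rightarrow> real"
  assumes "indep_var borel X borel Y"
  shows "concentration M r (\<lambda>\<omega>. X \<omega> + Y \<omega>) \<le> concentration M r Y"
  using prob_indep_sum_le[OF assms, of UNIV] by (intro concentration_leI) (simp add: prob_space)

text \<open>
  When $|Y| < t$, the value of $X$ lies within $t$ of the interval that $X + Y$ has to hit.
\<close>

lemma concentration_indep_sum_le_mult:
  fixes X Y :: "'a \<Rightarrow> real"
  assumes ind: "indep_var borel X borel Y"
  shows "concentration M r (\<lambda>\<omega>. X \<omega> + Y \<omega>)
    \<le> concentration M (2 * t + r) X * concentration M r Y + prob {\<omega> \<in> space M. \<bar>Y \<omega>\<bar> \<ge> t}"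
proof (rule concentration_leI)
  fix x
  have [measurable]: "X \<in> borel_measurable M" "Y \<in> borel_measurable M"
    using ind unfolding indep_var_distribution_eq by auto
  let ?J = "{x - t<..x + r + t}"
  let ?A = "{\<omega> \<in> space M. X \<omega> \<in> ?J \<and> x < X \<omega> + Y \<omega> \<and> X \<omega> + Y \<omega> \<le> x + r}"
  let ?B = "{\<omega> \<in> space M. \<bar>Y \<omega>\<bar> \<ge> t}"
  have "prob {\<omega> \<in> space M. x < X \<omega> + Y \<omega> \<and> X \<omega> + Y \<omega> \<le> x + r} \<le> prob (?A \<union> ?B)"
    by (rule finite_measure_mono) auto
  also have "\<dots> \<le> prob ?A + prob ?B"
    by (rule measure_Un_le) auto
  also have "prob ?A \<le> prob {\<omega> \<in> space M. X \<omega> \<in> ?J} * concentration M r Y"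
    by (rule prob_indep_sum_le[OF ind]) simp
  also have "prob {\<omega> \<in> space M. X \<omega> \<in> ?J} \<le> concentration M (2 * t + r) X"
    using prob_le_concentration[of "x - t" X "2 * t + r"] by (simp add: algebra_simps)
  finally show "prob {\<omega> \<in> space M. x < X \<omega> + Y \<omega> \<and> X \<omega> + Y \<omega> \<le> x + r}
      \<le> concentration M (2 * t + r) X * concentration M r Y + prob ?B"
    by (simp add: mult_right_mono concentration_nonneg)
qed

end

section \<open>Signed sums of Rademacher variables\<close>

locale rademacher = prob_space M for M :: "'a measure" +
  fixes \<epsilon> :: "'i \<Rightarrow> 'a \<Rightarrow> real" and I :: "'i set"
  assumes indep: "indep_vars (\<lambda>_. borel) \<epsilon> I"
    and prob_pos: "i \<in> I \<Longrightarrow> prob {\<omega> \<in> space M. \<epsilon> i \<omega> = 1} = 1 / 2"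
    and prob_neg: "i \<in> I \<Longrightarrow> prob {\<omega> \<in> space M. \<epsilon> i \<omega> = - 1} = 1 / 2"
begin

definition signed_sum :: "('i \<Rightarrow> real) \<Rightarrow> 'i set \<Rightarrow> 'a \<Rightarrow> real" where
  "signed_sum a A \<omega> = (\<Sum>i\<in>A. \<epsilon> i \<omega> * a i)"

lemma measurable_sign [measurable]: "i \<in> I \<Longrightarrow> \<epsilon> i \<in> borel_measurable M"
  using indep unfolding indep_vars_def2 by auto

lemma measurable_signed_sum [measurable]:
  "A \<subseteq> I \<Longrightarrow> signed_sum a A \<in> borel_measurable M"
  unfolding signed_sum_def[abs_def] by (intro borel_measurable_sum borel_measurable_times) auto

lemma AE_sign:
  assumes "i \<in> I"
  shows "AE \<omega> in M. \<epsilon> i \<omega> = 1 \<or> \<epsilon> i \<omega> = - 1"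
proof -
  note [measurable] = measurable_sign[OF assms]
  have "prob {\<omega> \<in> space M. \<epsilon> i \<omega> = 1 \<or> \<epsilon> i \<omega> = - 1}
      = prob ({\<omega> \<in> space M. \<epsilon> i \<omega> = 1} \<union> {\<omega> \<in> space M. \<epsilon> i \<omega> = - 1})"
    by (rule arg_cong[where f = prob]) auto
  also have "\<dots> = 1"
    by (subst finite_measure_Union) (auto simp: prob_pos[OF assms] prob_neg[OF assms])
  finally show ?thesis by (subst (asm) prob_Collect_eq_1) auto
qed

lemma expectation_sign:
  assumes "i \<in> I"
  shows "expectation (\<epsilon> i) = 0"
proof -
  note [measurable] = measurable_sign[OF assms]
  have "expectation (\<epsilon> i) = expectation (\<lambda>\<omega>. indicator {\<omega> \<in> space M. \<epsilon> i \<omega> = 1} \<omega>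
      - indicator {\<omega> \<in> space M. \<epsilon> i \<omega> = - 1} \<omega>)"
    using AE_sign[OF assms]
    by (intro integral_cong_AE) (auto elim!: eventually_mono simp: indicator_def)
  also have "\<dots> = 0"
    by (subst Bochner_Integration.integral_diff)
      (auto simp: prob_pos[OF assms] prob_neg[OF assms] Int_absorb2 less_top[symmetric] intro!: integrable_real_indicator)
  finally show ?thesis .
qed

lemma indep_signed_sums:
  assumes "A \<subseteq> I" "B \<subseteq> I" "A \<inter> B = {}"
  shows "indep_var borel (signed_sum a A) borel (signed_sum a B)"
proof -
  have eq: "(\<lambda>f. \<Sum>i\<in>S. f i * a i) \<circ> (\<lambda>\<omega>. restrict (\<lambda>i. \<epsilon> i \<omega>) S) = signed_sum a S" for S
    by (auto simp: signed_sum_def fun_eq_iff)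
  have "indep_var borel ((\<lambda>f. \<Sum>i\<in>A. f i * a i) \<circ> (\<lambda>\<omega>. restrict (\<lambda>i. \<epsilon> i \<omega>) A))
      borel ((\<lambda>f. \<Sum>i\<in>B. f i * a i) \<circ> (\<lambda>\<omega>. restrict (\<lambda>i. \<epsilon> i \<omega>) B))"
    by (rule indep_var_compose[OF indep_var_restrict[OF indep assms(3,1,2)]]) simp_all
  then show ?thesis by (simp only: eq)
qed

lemma signed_sum_Un:
  assumes "finite A" "finite B" "A \<inter> B = {}"
  shows "signed_sum a (A \<union> B) = (\<lambda>\<omega>. signed_sum a A \<omega> + signed_sum a B \<omega>)"
  unfolding signed_sum_def fun_eq_iff using assms by (simp add: sum.union_disjoint)

lemma concentration_signed_sum_antimono:
  assumes "finite B" "A \<subseteq> B" "B \<subseteq> I"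
  shows "concentration M r (signed_sum a B) \<le> concentration M r (signed_sum a A)"
proof -
  have "finite A" using assms finite_subset by blast
  have "signed_sum a B = signed_sum a ((B - A) \<union> A)" using assms by (simp add: Un_absorb1 Un_commute)
  also have "\<dots> = (\<lambda>\<omega>. signed_sum a (B - A) \<omega> + signed_sum a A \<omega>)"
    using assms \<open>finite A\<close> by (intro signed_sum_Un) auto
  finally have "signed_sum a B = (\<lambda>\<omega>. signed_sum a (B - A) \<omega> + signed_sum a A \<omega>)" .
  then show ?thesis
    using assms by (auto intro!: concentration_indep_sum_le indep_signed_sums)
qed

lemma prob_sign_pattern:
  assumes "finite A" "A \<subseteq> I"
  shows "prob {\<omega> \<in> space M. \<forall>i\<in>A. \<epsilon> i \<omega> = (if i \<in> S then 1 else - 1)} = (1 / 2) ^ card A"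
proof (cases "A = {}")
  case True
  then show ?thesis by (simp add: prob_space)
next
  case False
  let ?v = "\<lambda>i. if i \<in> S then 1 else - 1 :: real"
  have "{\<omega> \<in> space M. \<forall>i\<in>A. \<epsilon> i \<omega> = ?v i} = (\<Inter>i\<in>A. \<epsilon> i -` {?v i} \<inter> space M)"
    using False by auto
  also have "prob \<dots> = (\<Prod>i\<in>A. prob (\<epsilon> i -` {?v i} \<inter> space M))"
    by (rule indep_varsD[OF indep]) (use assms False in auto)
  also have "\<dots> = (\<Prod>i\<in>A. 1 / 2)"
  proof (rule prod.cong)
    fix i assume "i \<in> A"
    then have "i \<in> I" using assms by auto
    have "\<epsilon> i -` {v} \<inter> space M = {\<omega> \<in> space M. \<epsilon> i \<omega> = v}" for v by auto
    then show "prob (\<epsilon> i -` {?v i} \<inter> space M) = 1 / 2"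
      using prob_pos[OF \<open>i \<in> I\<close>] prob_neg[OF \<open>i \<in> I\<close>] by simp
  qed simp
  finally show ?thesis by simp
qed

text \<open>
  The argument of Erdos: if $S \subset T$, passing from the sign pattern with positive set $S$ to the
  one with positive set $T$ raises the signed sum by at least $2d$, which does not fit into a half-open
  interval of length $r \le 2d$. So the sign patterns that hit the interval form an antichain.
\<close>

theorem littlewood_offord:
  assumes A: "finite A" "A \<subseteq> I" and d: "d \<ge> 0" "\<And>i. i \<in> A \<Longrightarrow> d \<le> a i" and r: "r \<le> 2 * d"
  shows "concentration M r (signed_sum a A) \<le> real (card A choose (card A div 2)) / 2 ^ card A"
proof (rule concentration_leI)
  fix x
  define s where "s S = (\<Sum>i\<in>A. (if i \<in> S then 1 else - 1) * a i)" for S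
  define F where "F = {S \<in> Pow A. x < s S \<and> s S \<le> x + r}"
  define E where "E S = {\<omega> \<in> space M. \<forall>i\<in>A. \<epsilon> i \<omega> = (if i \<in> S then 1 else - 1)}" for S
  have [measurable]: "E S \<in> sets M" for S
    unfolding E_def using A by (intro sets.sets_Collect_finite_All) (auto intro!: borel_measurable_const)
  have finF: "finite F" unfolding F_def using A by auto
  have AE_signs: "AE \<omega> in M. \<forall>i\<in>A. \<epsilon> i \<omega> = 1 \<or> \<epsilon> i \<omega> = - 1"
    using A AE_sign by (intro AE_finite_allI) auto
  have cover: "\<omega> \<in> (\<Union>S\<in>F. E S)"
    if "\<omega> \<in> space M" "x < signed_sum a A \<omega>" "signed_sum a A \<omega> \<le> x + r"
      and signs: "\<forall>i\<in>A. \<epsilon> i \<omega> = 1 \<or> \<epsilon> i \<omega> = - 1" for \<omega>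
  proof -
    define S where "S = {i\<in>A. \<epsilon> i \<omega> = 1}"
    have "signed_sum a A \<omega> = s S"
      unfolding s_def S_def signed_sum_def using signs by (intro sum.cong) auto
    moreover have "\<omega> \<in> E S" unfolding E_def S_def using that(1) signs by auto
    moreover have "S \<subseteq> A" by (auto simp: S_def)
    ultimately show ?thesis using that(2,3) unfolding F_def by auto
  qed
  have "prob {\<omega> \<in> space M. x < signed_sum a A \<omega> \<and> signed_sum a A \<omega> \<le> x + r} \<le> prob (\<Union>S\<in>F. E S)"
  proof (rule finite_measure_mono_AE)
    show "AE \<omega> in M. \<omega> \<in> {\<omega> \<in> space M. x < signed_sum a A \<omega> \<and> signed_sum a A \<omega> \<le> x + r}
        \<longrightarrow> \<omega> \<in> (\<Union>S\<in>F. E S)"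
      using AE_signs by eventually_elim (blast intro!: cover)
  qed (use finF in auto)
  also have "\<dots> \<le> (\<Sum>S\<in>F. prob (E S))"
    using finF by (intro finite_measure_subadditive_finite) auto
  also have "\<dots> = real (card F) / 2 ^ card A"
    unfolding E_def by (simp add: prob_sign_pattern[OF A] power_divide)
  also have "\<dots> \<le> real (card A choose (card A div 2)) / 2 ^ card A"
  proof (intro divide_right_mono, unfold of_nat_le_iff, rule sperner)
    fix S T assume ST: "S \<in> F" "T \<in> F"
    show "\<not> S \<subset> T"
    proof
      assume "S \<subset> T"
      then obtain j where j: "j \<in> T" "j \<notin> S" by blast
      have "T \<subseteq> A" using ST by (auto simp: F_def)
      have "s T - s S = (\<Sum>i\<in>A. if i \<in> T - S then 2 * a i else 0)"
        unfolding s_def sum_subtractf[symmetric] using \<open>S \<subset> T\<close> by (intro sum.cong) auto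
      also have "\<dots> \<ge> (if j \<in> T - S then 2 * a j else 0)"
        using A \<open>T \<subseteq> A\<close> j d by (intro member_le_sum) (auto intro: order_trans)
      finally have "s T - s S \<ge> 2 * d" using j \<open>T \<subseteq> A\<close> d(2)[of j] by auto
      moreover have "s T - s S < r" using ST by (auto simp: F_def)
      ultimately show False using r by linarith
    qed
  qed (use A in \<open>auto simp: F_def\<close>)
  finally show "prob {\<omega> \<in> space M. x < signed_sum a A \<omega> \<and> signed_sum a A \<omega> \<le> x + r}
      \<le> real (card A choose (card A div 2)) / 2 ^ card A" .
qed

lemma signed_sum_tail:
  assumes A: "finite A" "A \<subseteq> I" "A \<noteq> {}" and L: "L > 0" "\<And>i. i \<in> A \<Longrightarrow> \<bar>a i\<bar> \<le> L" and "t \<ge> 0"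
  shows "prob {\<omega> \<in> space M. \<bar>signed_sum a A \<omega>\<bar> \<ge> t} \<le> 2 * exp (- (t\<^sup>2 / (2 * real (card A) * L\<^sup>2)))"
proof -
  have zero: "(\<Sum>i\<in>A. expectation (\<lambda>\<omega>. \<epsilon> i \<omega> * a i)) = 0"
    using A expectation_sign by (intro sum.neutral) (auto simp: subset_iff)
  interpret H: Hoeffding_ineq M A "\<lambda>i \<omega>. \<epsilon> i \<omega> * a i" "\<lambda>_. - L" "\<lambda>_. L"
    "\<Sum>i\<in>A. expectation (\<lambda>\<omega>. \<epsilon> i \<omega> * a i)"
  proof unfold_locales
    show "indep_vars (\<lambda>_. borel) (\<lambda>i \<omega>. \<epsilon> i \<omega> * a i) A"
      by (rule indep_vars_compose2[OF indep_vars_subset[OF indep A(2)], where Y = "\<lambda>i y. y * a i"]) simp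
    fix i assume i: "i \<in> A"
    then have "AE \<omega> in M. \<epsilon> i \<omega> = 1 \<or> \<epsilon> i \<omega> = - 1" using A AE_sign by auto
    then show "AE \<omega> in M. \<epsilon> i \<omega> * a i \<in> {- L..L}"
      using L(2)[OF i] by (auto elim!: eventually_mono)
  qed (use A in auto)
  have card: "card A > 0" using A by (simp add: card_gt_0_iff)
  have "prob {\<omega> \<in> space M. \<bar>signed_sum a A \<omega>\<bar> \<ge> t} \<le> 2 * exp (- 2 * t\<^sup>2 / (\<Sum>i\<in>A. (L - - L)\<^sup>2))"
    using H.Hoeffding_ineq_abs_ge[of t] L(1) card \<open>t \<ge> 0\<close> by (simp only: zero signed_sum_def) simp
  also have "- 2 * t\<^sup>2 / (\<Sum>i\<in>A. (L - - L)\<^sup>2) = - (t\<^sup>2 / (2 * real (card A) * L\<^sup>2))"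
    using L(1) card by (simp add: power2_eq_square field_simps)
  finally show ?thesis .
qed

end

section \<open>Polynomially growing coefficients\<close>

locale growing_rademacher_sum = rademacher M \<epsilon> "{1..}"
  for M :: "'a measure" and \<epsilon> :: "nat \<Rightarrow> 'a \<Rightarrow> real" +
  fixes a :: "nat \<Rightarrow> real" and c C \<alpha> \<delta> :: real
  assumes c: "c > 0" and C: "C > 0" and \<alpha>: "\<alpha> > 0" and \<delta>: "\<delta> \<ge> 0"
    and lower: "\<forall>\<^sub>F n in sequentially. c * real n powr \<alpha> \<le> a n"
    and upper: "n \<ge> 1 \<Longrightarrow> \<bar>a n\<bar> \<le> C * real n powr (\<alpha> + \<delta>)"
begin

abbreviation Q :: "nat \<Rightarrow> real" where
  "Q n \<equiv> concentration M 1 (signed_sum a {1..n})"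

text \<open>
  At least $2 \lfloor n/4 \rfloor$ of the indices exceed $n/2$, and their coefficients exceed
  every window of order $n^\kappa$ with $\kappa < \alpha$. Using an even number of them reduces the
  Littlewood--Offord bound to a central binomial coefficient.
\<close>

lemma concentration_upper_half:
  assumes \<kappa>: "0 < \<kappa>" "\<kappa> < \<alpha>"
  shows "\<forall>\<^sub>F n in sequentially. \<forall>m \<le> n div 2.
    concentration M (2 * real n powr \<kappa> + 1) (signed_sum a {m<..n}) \<le> 2 * real n powr (- 1 / 2)"
proof -
  obtain N where N: "c * real i powr \<alpha> \<le> a i" if "i \<ge> N" for i
    using lower unfolding eventually_sequentially by blast
  have window: "\<forall>\<^sub>F n in sequentially. 2 * real n powr \<kappa> + 1 \<le> 2 * (c * (real n / 2) powr \<alpha>)"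
    using \<kappa> \<alpha> c by real_asymp
  show ?thesis
    using window eventually_ge_at_top[of "2 * N"] eventually_ge_at_top[of 1]
  proof eventually_elim
    case (elim n)
    show ?case
    proof (intro allI impI)
      fix m assume m: "m \<le> n div 2"
      define k where "k = n div 4"
      define A where "A = {n - 2 * k<..n}"
      have card: "card A = 2 * k" unfolding A_def k_def by simp
      have "A \<subseteq> {m<..n}" unfolding A_def k_def using m by auto
      then have "concentration M (2 * real n powr \<kappa> + 1) (signed_sum a {m<..n})
          \<le> concentration M (2 * real n powr \<kappa> + 1) (signed_sum a A)"
        by (intro concentration_signed_sum_antimono) auto
      also have "\<dots> \<le> real (card A choose (card A div 2)) / 2 ^ card A"
      proof (rule littlewood_offord)
        show "c * (real n / 2) powr \<alpha> \<le> a i" if "i \<in> A" for i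
        proof -
          have "n \<le> 2 * i" using that unfolding A_def k_def by auto
          then have "c * (real n / 2) powr \<alpha> \<le> c * real i powr \<alpha>"
            using c \<alpha> by (intro mult_left_mono powr_mono2) auto
          also have "\<dots> \<le> a i" using \<open>n \<le> 2 * i\<close> elim by (intro N) auto
          finally show ?thesis .
        qed
      qed (use elim c in \<open>auto simp: A_def\<close>)
      also have "\<dots> \<le> 1 / sqrt (real (2 * k + 1))"
        using central_binomial_upper_bound[of k] by (simp add: card)
      also have "\<dots> \<le> 2 / sqrt (real n)"
      proof -
        have "n \<le> 4 * (2 * k + 1)" unfolding k_def by presburger
        then have "sqrt (real n) \<le> sqrt (4 * real (2 * k + 1))"
          by (intro real_sqrt_le_mono) linarith
        then have "sqrt (real n) \<le> 2 * sqrt (real (2 * k + 1))"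
          by (simp only: real_sqrt_mult real_sqrt_four)
        then show ?thesis using elim by (simp add: field_simps)
      qed
      also have "\<dots> = 2 * real n powr (- 1 / 2)"
        using elim by (simp add: powr_minus powr_half_sqrt field_simps)
      finally show "concentration M (2 * real n powr \<kappa> + 1) (signed_sum a {m<..n})
          \<le> 2 * real n powr (- 1 / 2)" .
    qed
  qed
qed

text \<open>
  The standard deviation of a sum of $n^\beta$ terms is at most of order
  $n^{\beta (\alpha + \delta + 1/2)}$, and Hoeffding's bound at a polynomially larger threshold is
  $\exp(-n^\xi / K)$ with $\xi > 0$, smaller than every power of $n$.
\<close>

lemma initial_segment_tail:
  assumes \<beta>: "\<beta> > 0" and \<kappa>: "\<beta> * (\<alpha> + \<delta> + 1 / 2) < \<kappa>"
  shows "(\<lambda>n. prob {\<omega> \<in> space M. \<bar>signed_sum a {1..nat \<lfloor>real n powr \<beta>\<rfloor>} \<omega>\<bar> \<ge> real n powr \<kappa>})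
    \<in> O(\<lambda>n. real n powr E)"
proof -
  define \<xi> where "\<xi> = 2 * (\<kappa> - \<beta> * (\<alpha> + \<delta> + 1 / 2))"
  have \<xi>: "\<xi> > 0" using \<kappa> by (simp add: \<xi>_def)
  have bound: "prob {\<omega> \<in> space M. \<bar>signed_sum a {1..nat \<lfloor>real n powr \<beta>\<rfloor>} \<omega>\<bar> \<ge> real n powr \<kappa>}
      \<le> 2 * exp (- (real n powr \<xi> / (2 * C\<^sup>2)))" if n: "n \<ge> 1" for n
  proof -
    define p where "p = real n powr \<beta>"
    define m where "m = nat \<lfloor>p\<rfloor>"
    define L where "L = C * p powr (\<alpha> + \<delta>)"
    have p: "p \<ge> 1" unfolding p_def using n \<beta> by (simp add: ge_one_powr_ge_zero)
    have m: "m \<ge> 1" "real m \<le> p" unfolding m_def using p by linarith+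
    have L: "L > 0" unfolding L_def using C p by simp
    have "prob {\<omega> \<in> space M. \<bar>signed_sum a {1..m} \<omega>\<bar> \<ge> real n powr \<kappa>}
        \<le> 2 * exp (- ((real n powr \<kappa>)\<^sup>2 / (2 * real (card {1..m}) * L\<^sup>2)))"
    proof (rule signed_sum_tail)
      show "\<bar>a i\<bar> \<le> L" if "i \<in> {1..m}" for i
      proof -
        have "\<bar>a i\<bar> \<le> C * real i powr (\<alpha> + \<delta>)" using that by (intro upper) auto
        also have "\<dots> \<le> L" unfolding L_def using that m C \<alpha> \<delta>
          by (intro mult_left_mono powr_mono2) auto
        finally show ?thesis .
      qed
    qed (use m L in auto)
    also have "\<dots> \<le> 2 * exp (- (real n powr \<xi> / (2 * C\<^sup>2)))"
    proof -
      have sq: "(x powr y)\<^sup>2 = x powr (2 * y)" if "x > 0" for x y :: real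
        using that by (simp add: power2_eq_square flip: powr_add)
      have "real n powr \<xi> / (2 * C\<^sup>2) = (real n powr \<kappa>)\<^sup>2 / (2 * p * L\<^sup>2)"
        unfolding \<xi>_def L_def p_def using n C
        by (simp add: sq powr_powr power_mult_distrib powr_diff field_simps flip: powr_add)
      also have "\<dots> \<le> (real n powr \<kappa>)\<^sup>2 / (2 * real (card {1..m}) * L\<^sup>2)"
        using m L by (intro divide_left_mono mult_right_mono) auto
      finally show ?thesis by simp
    qed
    finally show ?thesis unfolding m_def p_def .
  qed
  have "(\<lambda>n. prob {\<omega> \<in> space M. \<bar>signed_sum a {1..nat \<lfloor>real n powr \<beta>\<rfloor>} \<omega>\<bar> \<ge> real n powr \<kappa>})
      \<in> O(\<lambda>n. 2 * exp (- (real n powr \<xi> / (2 * C\<^sup>2))))"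
    by (intro landau_o.big_mono eventually_mono[OF eventually_ge_at_top[of 1]]) (use bound in auto)
  also have "(\<lambda>n. 2 * exp (- (real n powr \<xi> / (2 * C\<^sup>2)))) \<in> O(\<lambda>n. real n powr E)"
    using \<xi> C by real_asymp
  finally show ?thesis .
qed

text \<open>
  One round of the recursion: the terms beyond the initial segment of length $n^\beta$ contribute the
  factor $n^{-1/2}$, the initial segment contributes $(n^\beta)^{-e}$.
\<close>

lemma concentration_bootstrap:
  assumes \<beta>: "0 < \<beta>" "\<beta> < \<alpha> / (\<alpha> + \<delta> + 1 / 2)"
    and Q: "Q \<in> O(\<lambda>n. real n powr (- e))"
  shows "Q \<in> O(\<lambda>n. real n powr (- (1 / 2 + \<beta> * e)))"
proof -
  define m where "m n = nat \<lfloor>real n powr \<beta>\<rfloor>" for n :: nat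
  \<comment> \<open>any value strictly between the scale of the initial segment and $\alpha$\<close>
  define \<kappa> where "\<kappa> = (\<beta> * (\<alpha> + \<delta> + 1 / 2) + \<alpha>) / 2"
  define T where "T n = prob {\<omega> \<in> space M. \<bar>signed_sum a {1..m n} \<omega>\<bar> \<ge> real n powr \<kappa>}" for n
  have "\<beta> * (\<alpha> + \<delta> + 1 / 2) < \<alpha>" using \<beta> \<alpha> \<delta> by (simp add: field_simps)
  then have \<kappa>: "\<beta> * (\<alpha> + \<delta> + 1 / 2) < \<kappa>" "\<kappa> < \<alpha>" by (auto simp: \<kappa>_def)
  have "\<kappa> > 0" 
  proof -
    have "0 < \<beta> * (\<alpha> + \<delta> + 1 / 2)" using \<beta>(1) \<alpha> \<delta> by (intro mult_pos_pos) auto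
    with \<kappa>(1) show ?thesis by linarith
  qed
  have "\<beta> < 1" using \<beta>(2)
  proof (rule less_trans)
    show "\<alpha> / (\<alpha> + \<delta> + 1 / 2) < 1" using \<alpha> \<delta> by simp
  qed
  then have half: "\<forall>\<^sub>F n in sequentially. real n powr \<beta> \<le> real n / 2"
    using \<beta>(1) by real_asymp
  have recursion: "\<forall>\<^sub>F n in sequentially. Q n \<le> 2 * real n powr (- 1 / 2) * Q (m n) + T n"
    using half concentration_upper_half[OF \<open>\<kappa> > 0\<close> \<kappa>(2)]
  proof eventually_elim
    case (elim n)
    have "real (m n) \<le> real n / 2" using elim(1) unfolding m_def by linarith
    then have m: "m n \<le> n div 2" by linarith
    have "{1..n} = {m n<..n} \<union> {1..m n}" using m by auto
    then have "signed_sum a {1..n} = (\<lambda>\<omega>. signed_sum a {m n<..n} \<omega> + signed_sum a {1..m n} \<omega>)"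
      by (simp only:) (rule signed_sum_Un; auto)
    then have "Q n \<le> concentration M (2 * real n powr \<kappa> + 1) (signed_sum a {m n<..n}) * Q (m n) + T n"
      unfolding T_def by (simp only:) (intro concentration_indep_sum_le_mult indep_signed_sums; auto)
    also have "\<dots> \<le> 2 * real n powr (- 1 / 2) * Q (m n) + T n"
      using elim(2) m by (intro add_right_mono mult_right_mono concentration_nonneg) auto
    finally show ?case .
  qed
  have m_top: "filterlim m at_top sequentially"
    unfolding m_def[abs_def] using \<beta>(1) by real_asymp
  have "(\<lambda>n. Q (m n)) \<in> O(\<lambda>n. real (m n) powr (- e))"
    by (rule landau_o.big.compose[OF Q m_top])
  also have "(\<lambda>n. real (m n) powr (- e)) \<in> O(\<lambda>n. real n powr (- (\<beta> * e)))"
  proof -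
    have "(\<lambda>n. real (m n)) \<sim>[sequentially] (\<lambda>n. real n powr \<beta>)"
      unfolding m_def using \<beta>(1) by real_asymp
    then have "(\<lambda>n. real (m n) powr (- e)) \<sim>[sequentially] (\<lambda>n. (real n powr \<beta>) powr (- e))"
      by (rule asymp_equiv_powr_real) auto
    then show ?thesis by (simp add: powr_powr asymp_equiv_imp_bigo)
  qed
  finally have "(\<lambda>n. 2 * real n powr (- 1 / 2) * Q (m n))
      \<in> O(\<lambda>n. real n powr (- 1 / 2) * real n powr (- (\<beta> * e)))"
    by (intro landau_o.big.mult) auto
  also have "(\<lambda>n. real n powr (- 1 / 2) * real n powr (- (\<beta> * e)))
      = (\<lambda>n. real n powr (- (1 / 2 + \<beta> * e)))"
    by (simp add: fun_eq_iff flip: powr_add)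
  finally have main: "(\<lambda>n. 2 * real n powr (- 1 / 2) * Q (m n)) \<in> O(\<lambda>n. real n powr (- (1 / 2 + \<beta> * e)))" .
  have tail: "T \<in> O(\<lambda>n. real n powr (- (1 / 2 + \<beta> * e)))"
    unfolding T_def[abs_def] m_def by (rule initial_segment_tail[OF \<beta>(1) \<kappa>(1)])
  have "Q \<in> O(\<lambda>n. 2 * real n powr (- 1 / 2) * Q (m n) + T n)"
    using recursion by (intro landau_o.big_mono) (auto elim!: eventually_mono simp: concentration_nonneg)
  also have "\<dots> \<subseteq> O(\<lambda>n. real n powr (- (1 / 2 + \<beta> * e)))"
    by (rule landau_o.big_subsetI) (rule sum_in_bigo[OF main tail])
  finally show ?thesis .
qed

text \<open>
  The exponents obtained by iterating $e \mapsto 1/2 + \beta e$ from $0$ are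
  $(1 - \beta^k) / (2 (1 - \beta))$. They increase to $1 / (2 (1 - \beta))$, and this limit tends to
  $1/2 + \alpha / (1 + 2 \delta)$ as $\beta$ increases to $\beta_0$.
\<close>

theorem concentration_bound:
  assumes E: "E < 1 / 2 + \<alpha> / (1 + 2 * \<delta>)"
  shows "Q \<in> O(\<lambda>n. real n powr (- E))"
proof -
  define \<beta>\<^sub>0 where "\<beta>\<^sub>0 = \<alpha> / (\<alpha> + \<delta> + 1 / 2)"
  have \<beta>\<^sub>0: "0 < \<beta>\<^sub>0" "\<beta>\<^sub>0 < 1" unfolding \<beta>\<^sub>0_def using \<alpha> \<delta> by auto
  have "1 / (2 * (1 - \<beta>\<^sub>0)) = 1 / 2 + \<alpha> / (1 + 2 * \<delta>)"
    unfolding \<beta>\<^sub>0_def using \<alpha> \<delta> by (simp add: field_simps)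
  moreover have "((\<lambda>\<beta>. 1 / (2 * (1 - \<beta>))) \<longlongrightarrow> 1 / (2 * (1 - \<beta>\<^sub>0))) (at_left \<beta>\<^sub>0)"
    using \<beta>\<^sub>0 by (intro tendsto_intros) auto
  ultimately have "\<forall>\<^sub>F \<beta> in at_left \<beta>\<^sub>0. E < 1 / (2 * (1 - \<beta>))"
    using E by (intro order_tendstoD) auto
  moreover have "\<forall>\<^sub>F \<beta> in at_left \<beta>\<^sub>0. \<beta> \<in> {0<..<\<beta>\<^sub>0}"
    using \<beta>\<^sub>0(1) by (rule eventually_at_left_real)
  ultimately have "\<forall>\<^sub>F \<beta> in at_left \<beta>\<^sub>0. E < 1 / (2 * (1 - \<beta>)) \<and> \<beta> \<in> {0<..<\<beta>\<^sub>0}"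
    by (rule eventually_conj)
  then obtain \<beta> where \<beta>: "0 < \<beta>" "\<beta> < \<beta>\<^sub>0" "E < 1 / (2 * (1 - \<beta>))"
    by (auto dest!: eventually_happens)
  have iterate: "Q \<in> O(\<lambda>n. real n powr (- ((1 - \<beta> ^ k) / (2 * (1 - \<beta>)))))" for k
  proof (induction k)
    case 0
    have "Q \<in> O(\<lambda>_. 1)"
      using concentration_nonneg concentration_le_1 by (intro landau_o.big_mono always_eventually) auto
    also have "(\<lambda>_. 1) \<in> O(\<lambda>n. real n powr 0)"
      by (intro landau_o.big_mono eventually_mono[OF eventually_gt_at_top[of 0]]) auto
    finally show ?case by simp
  next
    case (Suc k)
    have "1 / 2 + \<beta> * ((1 - \<beta> ^ k) / (2 * (1 - \<beta>))) = (1 - \<beta> ^ Suc k) / (2 * (1 - \<beta>))"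
      using \<beta> \<beta>\<^sub>0 by (simp add: field_simps)
    then show ?case
      using concentration_bootstrap[OF \<beta>(1) \<beta>(2)[unfolded \<beta>\<^sub>0_def] Suc.IH] by simp
  qed
  have "(\<lambda>k. (1 - \<beta> ^ k) / (2 * (1 - \<beta>))) \<longlonglongrightarrow> (1 - 0) / (2 * (1 - \<beta>))"
    using \<beta> \<beta>\<^sub>0 by (intro tendsto_intros LIMSEQ_power_zero) auto
  then have "\<forall>\<^sub>F k in sequentially. E < (1 - \<beta> ^ k) / (2 * (1 - \<beta>))"
    using \<beta>(3) by (intro order_tendstoD) auto
  then obtain k where k: "E < (1 - \<beta> ^ k) / (2 * (1 - \<beta>))"
    by (auto dest!: eventually_happens)
  have "(\<lambda>n. real n powr (- ((1 - \<beta> ^ k) / (2 * (1 - \<beta>))))) \<in> O(\<lambda>n. real n powr (- E))"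
    using k by (intro landau_o.big_mono eventually_mono[OF eventually_ge_at_top[of 1]])
      (auto intro!: powr_mono)
  with iterate[of k] show ?thesis by (rule landau_o.big_trans)
qed

end

section \<open>Comparison of the exponents\<close>

text \<open>
  With $s = \sqrt{\delta^2 + \alpha \delta}$, the first branch is governed by the condition
  $s \le 1/2$. There $2 \alpha \delta \le 2 s^2 \le s$, hence
  $\alpha^2 (1 + 2 \delta) \le \alpha^2 + \alpha s$, which is at most the denominator of that branch.
\<close>

lemma f_exponent_le:
  assumes \<alpha>: "\<alpha> > 0" and \<delta>: "\<delta> \<ge> 0"
  shows "f_exponent \<alpha> \<delta> \<le> 1 / (1 + 2 * \<delta>)"
proof (cases "\<delta> \<le> (sqrt (\<alpha>\<^sup>2 + 1) - \<alpha>) / 2")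
  case True
  define s where "s = sqrt (\<delta>\<^sup>2 + \<alpha> * \<delta>)"
  have s: "s \<ge> 0" "s\<^sup>2 = \<delta>\<^sup>2 + \<alpha> * \<delta>" using assms by (auto simp: s_def)
  have "(2 * \<delta> + \<alpha>)\<^sup>2 \<le> (sqrt (\<alpha>\<^sup>2 + 1))\<^sup>2"
    using True assms by (intro power_mono) (auto simp: field_simps)
  then have "s\<^sup>2 \<le> (1 / 2)\<^sup>2"
    using s by (simp add: power2_eq_square algebra_simps)
  then have "s \<le> 1 / 2" by (rule power2_le_imp_le) simp
  then have "s * s \<le> s * (1 / 2)" using s by (intro mult_left_mono)
  then have "\<alpha> * \<delta> * 2 \<le> s"
    using s(2) mult_nonneg_nonneg[OF \<delta> \<delta>] unfolding power2_eq_square by linarith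
  then have "\<alpha> * (\<alpha> * \<delta> * 2) \<le> \<alpha> * s" using \<alpha> by (intro mult_left_mono) auto
  then have "\<alpha>\<^sup>2 * (1 + 2 * \<delta>) \<le> \<alpha>\<^sup>2 + \<alpha> * s"
    by (simp add: power2_eq_square algebra_simps)
  also have "\<dots> \<le> (\<alpha> + \<delta>) * (\<alpha> + 2 * \<delta> + 2 * s)"
    using s \<alpha> \<delta> by (simp add: power2_eq_square algebra_simps)
  finally have "\<alpha>\<^sup>2 / ((\<alpha> + \<delta>) * (\<alpha> + 2 * \<delta> + 2 * s)) \<le> 1 / (1 + 2 * \<delta>)"
    using s \<alpha> \<delta> by (simp add: frac_le_eq divide_le_eq pos_divide_le_eq pos_le_divide_eq mult_ac)
  then show ?thesis using True by (simp add: f_exponent_def s_def)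
next
  case False
  have "\<alpha>\<^sup>2 \<le> (\<alpha> + \<delta>) * (\<alpha> + 1 / 2 + \<delta>)"
    using \<alpha> \<delta> by (simp add: power2_eq_square algebra_simps)
  then have "\<alpha>\<^sup>2 / ((\<alpha> + \<delta>) * (\<alpha> + 1 / 2 + \<delta>)) / (1 + 2 * \<delta>) \<le> 1 / (1 + 2 * \<delta>)"
    using \<alpha> \<delta> by (intro divide_right_mono) auto
  then show ?thesis using False by (simp add: f_exponent_def mult_ac)
qed

theorem theorem7:
  fixes M :: "'a measure"
    and \<epsilon> :: "nat \<Rightarrow> 'a \<Rightarrow> real"
    and a :: "nat \<Rightarrow> real"
    and c C \<alpha> \<delta> \<gamma> :: real
  assumes "prob_space M"
    and "prob_space.indep_vars M (\<lambda>_. borel) \<epsilon> {1..}"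
    and "\<And>i. i \<ge> 1 \<Longrightarrow> measure M {\<omega> \<in> space M. \<epsilon> i \<omega> = 1} = 1 / 2"
    and "\<And>i. i \<ge> 1 \<Longrightarrow> measure M {\<omega> \<in> space M. \<epsilon> i \<omega> = - 1} = 1 / 2"
    and "\<And>n. n \<ge> 1 \<Longrightarrow> a n \<ge> 0"
    and "c > 0" and "C > 0" and "\<alpha> > 0" and "\<delta> \<ge> 0"
    and "\<forall>\<^sub>F n in sequentially.
           c * real n powr \<alpha> \<le> a n \<and> a n \<le> C * real n powr (\<alpha> + \<delta>)"
    and "\<gamma> > 0"
  shows "(\<lambda>n. concentration M 1 (\<lambda>\<omega>. \<Sum>i=1..n. \<epsilon> i \<omega> * a i))
           \<in> O[sequentially](\<lambda>n. real n powr (- (1 / 2 + \<alpha> * f_exponent \<alpha> \<delta> - \<gamma>)))"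
proof -
  interpret rademacher M \<epsilon> "{1..}"
    by (intro rademacher.intro rademacher_axioms.intro) (use assms in auto)
  obtain N where N: "\<And>n. n \<ge> N \<Longrightarrow> c * real n powr \<alpha> \<le> a n \<and> a n \<le> C * real n powr (\<alpha> + \<delta>)"
    using assms(10) unfolding eventually_sequentially by blast
  \<comment> \<open>Enlarging the constant makes the upper bound hold from the first term on.\<close>
  define C' where "C' = C + (\<Sum>i\<in>{1..N}. a i)"
  have "(\<Sum>i\<in>{1..N}. a i) \<ge> 0" using assms(5) by (intro sum_nonneg) auto
  then have C': "C' \<ge> C" by (simp add: C'_def)
  interpret growing_rademacher_sum M \<epsilon> a c C' \<alpha> \<delta>
  proof unfold_locales
    show "\<forall>\<^sub>F n in sequentially. c * real n powr \<alpha> \<le> a n"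
      using assms(10) by (rule eventually_mono) auto
    fix n :: nat assume n: "n \<ge> 1"
    show "\<bar>a n\<bar> \<le> C' * real n powr (\<alpha> + \<delta>)"
    proof (cases "n \<le> N")
      case True
      have "a n \<le> (\<Sum>i\<in>{1..N}. a i)"
        using True n assms(5) by (intro member_le_sum) auto
      also have "\<dots> \<le> C' * 1" using assms(7) by (simp add: C'_def)
      also have "\<dots> \<le> C' * real n powr (\<alpha> + \<delta>)"
        using n assms(7-9) C' by (intro mult_left_mono ge_one_powr_ge_zero) auto
      finally show ?thesis using assms(5) n by simp
    next
      case False
      then have "a n \<le> C * real n powr (\<alpha> + \<delta>)" using N by auto
      also have "\<dots> \<le> C' * real n powr (\<alpha> + \<delta>)" using C' by (intro mult_right_mono) auto
      finally show ?thesis using assms(5) n by simp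
    qed
  qed (use assms(6-9) C' in auto)
  have "\<alpha> * f_exponent \<alpha> \<delta> \<le> \<alpha> * (1 / (1 + 2 * \<delta>))"
    using assms(8,9) by (intro mult_left_mono f_exponent_le) auto
  then have "1 / 2 + \<alpha> * f_exponent \<alpha> \<delta> - \<gamma> < 1 / 2 + \<alpha> / (1 + 2 * \<delta>)"
    using assms(11) by simp
  from concentration_bound[OF this] show ?thesis
    by (simp only: signed_sum_def[abs_def])
qed

end
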